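(* Let $a,b\in\mathbb{C}$ and let $f:\mathcal{W}(a,b)\times\mathcal{W}(a,b)\to\mathcal{W}(a,b)$ be a biderivation of the Lie algebra $\mathcal{W}(a,b)$. Then there exist $\lambda,\mu\in\mathbb{C}$ and a sequence $\Omega=(\mu_k)_{k\in\mathbb{Z}}$ of complex numbers with only finitely many nonzero entries such that, for all $x,y\in\mathcal{W}(a,b)$, $$f(x,y)=\begin{cases}\lambda[x,y]+\Psi_\Omega(x,y), & \text{if } b=0,\\ \lambda[x,y]+\Upsilon^a_\Omega(x,y), & \text{if } b=1,\\ \lambda[x,y]+\Theta^a_\mu(x,y), & \text{if } a\in\mathbb{Z},\ b=-1,\\ \lambda[x,y], & \text{otherwise.}\end{cases}$$
   Context: All vector spaces and algebras are over $\mathbb{C}$. For $a,b\in\mathbb{C}$, $\mathcal{W}(a,b)$ is the complex Lie algebra with basis $\{L_m,I_m\mid m\in\mathbb{Z}\}$ and brackets $$[L_m,L_n]=(m-n)L_{m+n},\quad [L_m,I_n]=-(n+a+bm)I_{m+n},\quad [I_m,I_n]=0\qquad(m,n\in\mathbb{Z}).$$ A biderivation of a Lie algebra $L$ is a bilinear map $f:L\times L\to L$ such that for all $x,y,z\in L$: $f([x,y],z)=[x,f(y,z)]+[f(x,z),y]$ and $f(x,[y,z])=[f(x,y),z]+[y,f(x,z)]$. For a sequence $\Omega=(\mu_k)_{k\in\mathbb{Z}}$ of complex numbers with only finitely many nonzero entries and $\mu\in\mathbb{C}$, the following bilinear maps are defined on basis elements (for all $m,n\in\mathbb{Z}$): -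 On $\mathcal{W}(a,0)$: $\Psi_\Omega(L_m,L_n)=\sum_{k\in\mathbb{Z}}\mu_k I_{m+n+k}$, and $\Psi_\Omega(L_m,I_n)=\Psi_\Omega(I_n,L_m)=\Psi_\Omega(I_m,I_n)=0$. - On $\mathcal{W}(a,1)$: $\Upsilon^a_\Omega(L_m,L_n)=\sum_{k\in\mathbb{Z}}(m+n+k+a)\mu_k I_{m+n+k}$, and $\Upsilon^a_\Omega(L_m,I_n)=\Upsilon^a_\Omega(I_n,L_m)=\Upsilon^a_\Omega(I_m,I_n)=0$. - On $\mathcal{W}(a,-1)$ with $a\in\mathbb{Z}$: $\Theta^a_\mu(L_m,L_n)=(m-n)\mu I_{m+n-a}$, and $\Theta^a_\mu(L_m,I_n)=\Theta^a_\mu(I_n,L_m)=\Theta^a_\mu(I_m,I_n)=0$. *)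

theory Defs
  imports Complex_Main "HOL-Library.Poly_Mapping"
begin

section \<open>Lie algebras and biderivations\<close>

definition bilinear_map :: "('k::field \<Rightarrow> 'v::ab_group_add \<Rightarrow> 'v) \<Rightarrow> ('v \<Rightarrow> 'v \<Rightarrow> 'v) \<Rightarrow> bool" where
  "bilinear_map scale f \<longleftrightarrow>
     (\<forall>x. Vector_Spaces.linear scale scale (f x)) \<and>
     (\<forall>y. Vector_Spaces.linear scale scale (\<lambda>x. f x y))"

locale lie_algebra = vector_space scale
  for scale :: "'k::field \<Rightarrow> 'v::ab_group_add \<Rightarrow> 'v" +
  fixes bracket :: "'v \<Rightarrow> 'v \<Rightarrow> 'v"
  assumes bracket_bilinear: "bilinear_map scale bracket"
    and bracket_self: "bracket x x = 0"
    and jacobi: "bracket x (bracket y z) + bracket y (bracket z x) + bracket z (bracket x y) = 0"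

definition biderivation ::
    "('k::field \<Rightarrow> 'v::ab_group_add \<Rightarrow> 'v) \<Rightarrow> ('v \<Rightarrow> 'v \<Rightarrow> 'v) \<Rightarrow> ('v \<Rightarrow> 'v \<Rightarrow> 'v) \<Rightarrow> bool" where
  "biderivation scale bracket f \<longleftrightarrow>
     bilinear_map scale f \<and>
     (\<forall>x y z. f (bracket x y) z = bracket x (f y z) + bracket (f x z) y) \<and>
     (\<forall>x y z. f x (bracket y z) = bracket (f x y) z + bracket y (f x z))"


section \<open>The underlying vector space\<close>

datatype windex = L_idx int | I_idx int

text \<open>The space is the set of finitely supported functions from the index set to \<open>\<complex>\<close>;
  it does not depend on the parameters \<open>a\<close>, \<open>b\<close>.\<close>

type_synonym W = "windex \<Rightarrow>\<^sub>0 complex"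

definition wscale :: "complex \<Rightarrow> W \<Rightarrow> W" where
  "wscale c = Poly_Mapping.map ((*) c)"

definition wL :: "int \<Rightarrow> W" where
  "wL m = Poly_Mapping.single (L_idx m) 1"

definition wI :: "int \<Rightarrow> W" where
  "wI m = Poly_Mapping.single (I_idx m) 1"

fun wbasis :: "windex \<Rightarrow> W" where
  "wbasis (L_idx m) = wL m"
| "wbasis (I_idx m) = wI m"

lemma lookup_wscale [simp]: "Poly_Mapping.lookup (wscale c x) i = c * Poly_Mapping.lookup x i"
  by (simp add: wscale_def Poly_Mapping.map.rep_eq when_def)

interpretation W: vector_space wscale
  by unfold_locales (auto intro!: poly_mapping_eqI simp: lookup_add algebra_simps)

lemma wbasis_eq: "wbasis i = Poly_Mapping.single i 1"
  by (cases i) (simp_all add: wL_def wI_def)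

lemma W_expansion: "(\<Sum>i\<in>Poly_Mapping.keys x. wscale (Poly_Mapping.lookup x i) (wbasis i)) = x"
  by (rule poly_mapping_eqI)
    (simp add: lookup_sum wbasis_eq lookup_single when_def in_keys_iff if_distrib cong: if_cong)

lemma W_span_basis: "W.span (range wbasis) = UNIV"
proof -
  have "x \<in> W.span (range wbasis)" for x
    by (subst W_expansion[symmetric]) (intro W.span_sum W.span_scale W.span_base, simp)
  thus ?thesis by blast
qed

lemma W_independent_basis: "W.independent (range wbasis)"
proof -
  have inj: "inj wbasis"
    by (auto simp: inj_def wbasis_eq poly_mapping_eq_iff fun_eq_iff lookup_single when_def split: if_splits)
  show ?thesis
    unfolding W.independent_explicit_module
  proof (intro allI impI)
    fix t u v
    assume t: "finite t" "t \<subseteq> range wbasis" and s: "(\<Sum>v\<in>t. wscale (u v) v) = 0" and v: "v \<in> t"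
    obtain T where T: "t = wbasis ` T" "finite T"
      using t by (meson finite_subset_image)
    obtain i where i: "i \<in> T" "v = wbasis i" using T v by blast
    have "0 = Poly_Mapping.lookup (\<Sum>j\<in>T. wscale (u (wbasis j)) (wbasis j)) i"
      using s inj by (simp add: T sum.reindex inj_on_subset[OF inj])
    also have "\<dots> = u v"
      using i T by (simp add: lookup_sum wbasis_eq lookup_single when_def if_distrib cong: if_cong)
    finally show "u v = 0" by simp
  qed
qed


section \<open>Bilinear maps given on the basis\<close>

definition bilinear_ext :: "(windex \<Rightarrow> windex \<Rightarrow> W) \<Rightarrow> W \<Rightarrow> W \<Rightarrow> W" where
  "bilinear_ext \<beta> x y =
     (\<Sum>i\<in>Poly_Mapping.keys x. \<Sum>j\<in>Poly_Mapping.keys y.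
        wscale (Poly_Mapping.lookup x i * Poly_Mapping.lookup y j) (\<beta> i j))"

lemma bilinear_ext_superset:
  assumes "finite A" "Poly_Mapping.keys x \<subseteq> A" "finite B" "Poly_Mapping.keys y \<subseteq> B"
  shows "bilinear_ext \<beta> x y =
    (\<Sum>i\<in>A. \<Sum>j\<in>B. wscale (Poly_Mapping.lookup x i * Poly_Mapping.lookup y j) (\<beta> i j))"
proof -
  have "bilinear_ext \<beta> x y = (\<Sum>i\<in>Poly_Mapping.keys x. \<Sum>j\<in>B.
      wscale (Poly_Mapping.lookup x i * Poly_Mapping.lookup y j) (\<beta> i j))"
    unfolding bilinear_ext_def using assms
    by (intro sum.cong refl sum.mono_neutral_left) (auto simp: in_keys_iff)
  also have "\<dots> = (\<Sum>i\<in>A. \<Sum>j\<in>B. wscale (Poly_Mapping.lookup x i * Poly_Mapping.lookup y j) (\<beta> i j))"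
    using assms by (intro sum.mono_neutral_left) (auto simp: in_keys_iff)
  finally show ?thesis .
qed

lemma bilinear_ext_basis [simp]: "bilinear_ext \<beta> (wbasis i) (wbasis j) = \<beta> i j"
  by (simp add: bilinear_ext_def wbasis_eq)

lemma bilinear_ext_bilinear: "bilinear_map wscale (bilinear_ext \<beta>)"
proof -
  have 1: "bilinear_ext \<beta> x (y + y') = bilinear_ext \<beta> x y + bilinear_ext \<beta> x y'" for x y y'
  proof -
    let ?B = "Poly_Mapping.keys y \<union> Poly_Mapping.keys y'"
    show ?thesis
      by (simp add: bilinear_ext_superset[of "Poly_Mapping.keys x" x ?B] keys_add
          lookup_add distrib_left distrib_right W.scale_left_distrib sum.distrib)
  qed
  have 2: "bilinear_ext \<beta> (x + x') y = bilinear_ext \<beta> x y + bilinear_ext \<beta> x' y" for x x' y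
  proof -
    let ?A = "Poly_Mapping.keys x \<union> Poly_Mapping.keys x'"
    show ?thesis
      by (simp add: bilinear_ext_superset[of ?A _ "Poly_Mapping.keys y" y] keys_add
          lookup_add distrib_left distrib_right W.scale_left_distrib sum.distrib)
  qed
  have k: "Poly_Mapping.keys (wscale c x) \<subseteq> Poly_Mapping.keys x" for c x
    by (auto simp: in_keys_iff)
  have 3: "bilinear_ext \<beta> x (wscale c y) = wscale c (bilinear_ext \<beta> x y)" for c x y
    by (simp add: bilinear_ext_superset[of "Poly_Mapping.keys x" x "Poly_Mapping.keys y"] k
        W.scale_sum_right mult_ac)
  have 4: "bilinear_ext \<beta> (wscale c x) y = wscale c (bilinear_ext \<beta> x y)" for c x y
    by (simp add: bilinear_ext_superset[of "Poly_Mapping.keys x" _ "Poly_Mapping.keys y"] k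
        W.scale_sum_right mult_ac)
  show ?thesis
    unfolding bilinear_map_def Vector_Spaces.linear_iff
    by (auto simp: 1 2 3 4 intro: W.vector_space_axioms)
qed


section \<open>The Lie algebra \<open>W(a,b)\<close>\<close>

fun wbracket_basis :: "complex \<Rightarrow> complex \<Rightarrow> windex \<Rightarrow> windex \<Rightarrow> W" where
  "wbracket_basis a b (L_idx m) (L_idx n) = wscale (of_int (m - n)) (wL (m + n))"
| "wbracket_basis a b (L_idx m) (I_idx n) = wscale (- (of_int n + a + b * of_int m)) (wI (m + n))"
| "wbracket_basis a b (I_idx n) (L_idx m) = wscale (of_int n + a + b * of_int m) (wI (m + n))"
| "wbracket_basis a b (I_idx m) (I_idx n) = 0"

definition wbracket :: "complex \<Rightarrow> complex \<Rightarrow> W \<Rightarrow> W \<Rightarrow> W" where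
  "wbracket a b = bilinear_ext (wbracket_basis a b)"

lemma wbracket_simps [simp]:
  "wbracket a b (wL m) (wL n) = wscale (of_int (m - n)) (wL (m + n))"
  "wbracket a b (wL m) (wI n) = wscale (- (of_int n + a + b * of_int m)) (wI (m + n))"
  "wbracket a b (wI n) (wL m) = wscale (of_int n + a + b * of_int m) (wI (m + n))"
  "wbracket a b (wI m) (wI n) = 0"
  using bilinear_ext_basis[of "wbracket_basis a b" "L_idx m" "L_idx n"]
    bilinear_ext_basis[of "wbracket_basis a b" "L_idx m" "I_idx n"]
    bilinear_ext_basis[of "wbracket_basis a b" "I_idx n" "L_idx m"]
    bilinear_ext_basis[of "wbracket_basis a b" "I_idx m" "I_idx n"]
  by (simp_all add: wbracket_def)

lemma wbracket_bilinear: "bilinear_map wscale (wbracket a b)"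
  by (simp add: wbracket_def bilinear_ext_bilinear)

lemma wbracket_linear_simps:
  "wbracket a b x (y + z) = wbracket a b x y + wbracket a b x z"
  "wbracket a b (x + y) z = wbracket a b x z + wbracket a b y z"
  "wbracket a b x (wscale c y) = wscale c (wbracket a b x y)"
  "wbracket a b (wscale c x) y = wscale c (wbracket a b x y)"
  using wbracket_bilinear[of a b] by (auto simp: bilinear_map_def Vector_Spaces.linear_iff)

lemma wbracket_zero [simp]: "wbracket a b 0 x = 0" "wbracket a b x 0 = 0"
  using wbracket_linear_simps(4)[of a b 0 0 x] wbracket_linear_simps(3)[of a b x 0 0] by simp_all

lemma W_induct [case_names zero add scale L I]:
  assumes "P 0" "\<And>x y. P x \<Longrightarrow> P y \<Longrightarrow> P (x + y)" "\<And>c x. P x \<Longrightarrow> P (wscale c x)"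
    "\<And>m. P (wL m)" "\<And>m. P (wI m)"
  shows "P x"
proof -
  have b: "P (wbasis i)" for i using assms by (cases i) auto
  have "P (\<Sum>i\<in>A. wscale (u i) (wbasis i))" if "finite A" for A u
    using that by (induction A rule: finite_induct) (auto intro: assms b)
  from this[of "Poly_Mapping.keys x" "Poly_Mapping.lookup x"] show ?thesis
    by (simp add: W_expansion)
qed

interpretation W: lie_algebra wscale "wbracket a b" for a b
proof
  show "bilinear_map wscale (wbracket a b)" by (rule wbracket_bilinear)
  let ?A = "\<lambda>x y. wbracket a b x y + wbracket a b y x"
  have Aadd: "?A (x + x') y = ?A x y + ?A x' y" "?A x (y + y') = ?A x y + ?A x y'" for x x' y y'
    by (simp_all add: wbracket_linear_simps)
  have Asc: "?A (wscale c x) y = wscale c (?A x y)" "?A x (wscale c y) = wscale c (?A x y)" for c x y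
    by (simp_all add: wbracket_linear_simps W.scale_right_distrib)
  have Ab: "?A (wbasis i) (wbasis j) = 0" for i j
    by (cases i; cases j) (simp_all add: add.commute W.scale_left_distrib[symmetric])
  have Ab2: "?A (wbasis i) y = 0" for i y
  proof (induction y rule: W_induct)
    case (L m) show ?case using Ab[of i "L_idx m"] by simp
  next
    case (I m) show ?case using Ab[of i "I_idx m"] by simp
  qed (simp_all only: Aadd Asc, simp_all)
  have anti: "?A x y = 0" for x y
  proof (induction x rule: W_induct)
    case (L m) show ?case using Ab2[of "L_idx m"] by simp
  next
    case (I m) show ?case using Ab2[of "I_idx m"] by simp
  qed (simp_all only: Aadd Asc, simp_all)
  show "wbracket a b x x = 0" for x
  proof -
    have "wscale 2 (wbracket a b x x) = wbracket a b x x + wbracket a b x x"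
      using W.scale_left_distrib[of 1 1 "wbracket a b x x"] by simp
    thus ?thesis using anti[of x x] by simp
  qed
  let ?J = "\<lambda>x y z. wbracket a b x (wbracket a b y z) + wbracket a b y (wbracket a b z x)
    + wbracket a b z (wbracket a b x y)"
  have Jadd: "?J (x + x') y z = ?J x y z + ?J x' y z" "?J x (y + y') z = ?J x y z + ?J x y' z"
      "?J x y (z + z') = ?J x y z + ?J x y z'" for x x' y y' z z'
    by (simp_all add: wbracket_linear_simps algebra_simps)
  have Jsc: "?J (wscale c x) y z = wscale c (?J x y z)" "?J x (wscale c y) z = wscale c (?J x y z)"
      "?J x y (wscale c z) = wscale c (?J x y z)" for c x y z
    by (simp_all add: wbracket_linear_simps W.scale_right_distrib)
  have comb: "wscale p (h i) + wscale q (h j) + wscale r (h k) = 0"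
    if "i = k" "j = k" "p + q + r = 0" for p q r and h :: "int \<Rightarrow> W" and i j k
    using that by (simp flip: W.scale_left_distrib)
  have basis: "?J (wbasis i) (wbasis j) (wbasis k) = 0" for i j k
    by (cases i; cases j; cases k; simp only: wbasis.simps wbracket_simps wbracket_linear_simps
        wbracket_zero W.scale_scale W.scale_zero_right add_0_left add_0_right)
      ((rule comb; simp add: algebra_simps)+)
  have Jb: "?J (wbasis i) (wbasis j) z = 0" for i j z
  proof (induction z rule: W_induct)
    case (L m) show ?case using basis[of i j "L_idx m"] by simp
  next
    case (I m) show ?case using basis[of i j "I_idx m"] by simp
  qed (simp_all only: Jadd Jsc, simp_all)
  have Jb2: "?J (wbasis i) y z = 0" for i y z
  proof (induction y rule: W_induct)
    case (L m) show ?case using Jb[of i "L_idx m"] by simp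
  next
    case (I m) show ?case using Jb[of i "I_idx m"] by simp
  qed (simp_all only: Jadd Jsc, simp_all)
  show "?J x y z = 0" for x y z
  proof (induction x rule: W_induct)
    case (L m) show ?case using Jb2[of "L_idx m"] by simp
  next
    case (I m) show ?case using Jb2[of "I_idx m"] by simp
  qed (simp_all only: Jadd Jsc, simp_all)
qed


section \<open>The exceptional biderivations\<close>

fun LL_basis :: "(int \<Rightarrow> int \<Rightarrow> W) \<Rightarrow> windex \<Rightarrow> windex \<Rightarrow> W" where
  "LL_basis g (L_idx m) (L_idx n) = g m n"
| "LL_basis g (L_idx m) (I_idx n) = 0"
| "LL_basis g (I_idx n) (L_idx m) = 0"
| "LL_basis g (I_idx m) (I_idx n) = 0"

text \<open>\<open>\<Psi>\<close> and \<open>\<Upsilon>\<close> are meaningful only if \<open>\<Omega>\<close> has finite support;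
  otherwise the sums below are zero.\<close>

definition Psi :: "(int \<Rightarrow> complex) \<Rightarrow> W \<Rightarrow> W \<Rightarrow> W" where
  "Psi \<Omega> = bilinear_ext (LL_basis (\<lambda>m n.
     \<Sum>k | \<Omega> k \<noteq> 0. wscale (\<Omega> k) (wI (m + n + k))))"

definition Upsilon :: "complex \<Rightarrow> (int \<Rightarrow> complex) \<Rightarrow> W \<Rightarrow> W \<Rightarrow> W" where
  "Upsilon a \<Omega> = bilinear_ext (LL_basis (\<lambda>m n.
     \<Sum>k | \<Omega> k \<noteq> 0. wscale ((of_int (m + n + k) + a) * \<Omega> k) (wI (m + n + k))))"

text \<open>\<open>\<Theta>\<close> is meaningful only for \<open>a \<in> \<int>\<close>; then \<open>\<lfloor>Re a\<rfloor>\<close> is \<open>a\<close> as an integer.\<close>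

definition Theta :: "complex \<Rightarrow> complex \<Rightarrow> W \<Rightarrow> W \<Rightarrow> W" where
  "Theta a \<mu> = bilinear_ext (LL_basis (\<lambda>m n.
     wscale (of_int (m - n) * \<mu>) (wI (m + n - \<lfloor>Re a\<rfloor>))))"

end

theory Submission
  imports Defs
begin

text \<open>
  Fix a degree \<open>k\<close>. The coefficients \<open>B(m, n)\<close> of \<open>f(L\<^sub>m, L\<^sub>n)\<close> at \<open>L\<^bsub>m+n+k\<^esub>\<close> and at \<open>I\<^bsub>m+n+k\<^esub>\<close>
  satisfy the same pair of functional equations, with parameters \<open>(k, -1)\<close> and \<open>(k + a, b)\<close>.
  Putting one argument to \<open>0\<close> expresses \<open>B(m, n)\<close> through \<open>B(m, 0)\<close> and also through
  \<open>B(0, n)\<close>; comparing the two expressions determines \<open>B\<close> away from one exceptional point,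
  where the full equation takes over. The \<open>L\<close>-coefficients give \<open>\<lambda>\<close>. Once \<open>\<lambda>[x, y]\<close> is
  subtracted from \<open>f\<close>, comparing \<open>L\<^sub>0\<close>-weights shows that \<open>f\<close> vanishes as soon as one argument
  is some \<open>I\<^sub>n\<close>, and the \<open>I\<close>-coefficients of \<open>f(L\<^sub>m, L\<^sub>n)\<close> give the exceptional families.
\<close>

section \<open>Biderivations of the Witt algebra with values in densities\<close>

text \<open>The identities for \<open>f(L\<^sub>m, L\<^sub>n) = B(m, n) v\<^bsub>m+n\<^esub>\<close>, where \<open>L\<^sub>m\<close> acts on the density module
  with basis \<open>v\<^sub>n\<close> by \<open>L\<^sub>m v\<^sub>n = -(n + s + b m) v\<^bsub>m+n\<^esub>\<close>. For \<open>s = 0\<close>, \<open>b = -1\<close> this is the adjoint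
  module.\<close>

definition density_biderivation :: "complex \<Rightarrow> complex \<Rightarrow> (int \<Rightarrow> int \<Rightarrow> complex) \<Rightarrow> bool" where
  "density_biderivation s b B \<longleftrightarrow>
     (\<forall>m n p. of_int (m - n) * B (m + n) p =
        (of_int (m + p) + s + b * of_int n) * B m p - (of_int (n + p) + s + b * of_int m) * B n p) \<and>
     (\<forall>m n p. of_int (n - p) * B m (n + p) =
        (of_int (m + n) + s + b * of_int p) * B m n - (of_int (m + p) + s + b * of_int n) * B m p)"

lemma density_biderivationD:
  assumes "density_biderivation s b B"
  shows "of_int (m - n) * B (m + n) p =
      (of_int (m + p) + s + b * of_int n) * B m p - (of_int (n + p) + s + b * of_int m) * B n p"
    and "of_int (n - p) * B m (n + p) =
      (of_int (m + n) + s + b * of_int p) * B m n - (of_int (m + p) + s + b * of_int n) * B m p"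
  using assms unfolding density_biderivation_def by blast+

lemma density_biderivation_diff:
  assumes B: "density_biderivation s b B" and B': "density_biderivation s b B'"
  shows "density_biderivation s b (\<lambda>m n. B m n - B' m n)"
  unfolding density_biderivation_def right_diff_distrib
    density_biderivationD[OF B] density_biderivationD[OF B']
  by simp

text \<open>The solutions to be subtracted from an unknown \<open>B\<close>. The third is a multiple
  of the bracket of the Witt algebra, in its adjoint module.\<close>

lemma density_biderivation_model:
  "density_biderivation s 0 (\<lambda>m n. c)"
  "density_biderivation s 1 (\<lambda>m n. (of_int (m + n) + s) * c)"
  "density_biderivation 0 (-1) (\<lambda>m n. of_int (m - n) * c)"
  by (simp_all add: density_biderivation_def algebra_simps)

text \<open>The left factors vanish only at index \<open>- s\<close>, so the values on the two axes
  determine \<open>B\<close> at every point except \<open>m = n = - s\<close>.\<close>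

lemma density_biderivation_zero:
  assumes "density_biderivation s b B"
  shows "(of_int m + s) * B m n = (of_int m + s + b * of_int n) * B m 0"
    and "(of_int n + s) * B m n = (of_int n + s + b * of_int m) * B 0 n"
  using density_biderivationD(2)[OF assms, of 0 n m] density_biderivationD(1)[OF assms, of 0 m n]
  by (simp_all add: algebra_simps)

text \<open>At the one point left open, \<open>L\<^sub>m\<close> is a nonzero multiple of a bracket
  of two \<open>L\<close>'s with indices other than \<open>m\<close>, so the first identity carries
  the vanishing over.\<close>

lemma density_biderivation_eq_0:
  assumes B: "density_biderivation s b B"
    and off: "\<And>m n. of_int m + s \<noteq> 0 \<or> of_int n + s \<noteq> 0 \<Longrightarrow> B m n = 0"
  shows "B m n = 0"
proof (cases "of_int m + s = 0")
  case True
  \<comment> \<open>This size makes \<open>p\<close> and \<open>m - p\<close> distinct from each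
    other and from \<open>m\<close>, whatever the sign of \<open>m\<close>.\<close>
  define p where "p = \<bar>m\<bar> + 1"
  have ne: "p \<noteq> m" "m - p \<noteq> m" "p - (m - p) \<noteq> 0"
    by (auto simp: p_def)
  have "B q n = 0" if "q \<noteq> m" for q
    using that True by (intro off) (metis add_right_cancel of_int_eq_iff)
  hence "B p n = 0" "B (m - p) n = 0"
    using ne by auto
  hence "of_int (p - (m - p)) * B m n = 0"
    using density_biderivationD(1)[OF B, of p "m - p" n] by simp
  thus ?thesis
    using ne(3) by (simp only: mult_eq_0_iff of_int_eq_0_iff) simp
qed (simp add: off)

text \<open>For \<open>s \<noteq> 0\<close> the origin is not exceptional: it determines both axes,
  and these determine the rest.\<close>

lemma density_biderivation_eq_0_generic:
  assumes B: "density_biderivation s b B" and "s \<noteq> 0" "B 0 0 = 0"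
  shows "B m n = 0"
proof (rule density_biderivation_eq_0[OF B])
  fix m n
  note z = density_biderivation_zero[OF B]
  have "B m 0 = 0" "B 0 n = 0"
    using z(2)[of 0 m] z(1)[of 0 n] assms by simp_all
  thus "B m n = 0" if "of_int m + s \<noteq> 0 \<or> of_int n + s \<noteq> 0"
    using z(1)[of m n] z(2)[of n m] that by auto
qed

lemma density_biderivation_generic:
  assumes B: "density_biderivation s b B" and s: "s \<noteq> 0"
  shows "\<exists>c. \<forall>m n. B m n =
    (if b = 0 then c else if b = 1 then (of_int (m + n) + s) * c else 0)"
proof -
  note z = density_biderivation_zero[OF B]
  have "b = 0 \<or> b = 1 \<or> B 0 0 = 0"
  proof -
    \<comment> \<open>Both axes are multiples of \<open>B 0 0\<close>; cross-multiplying the two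
      expressions for \<open>B m n\<close> leaves a polynomial factor that is nonzero for suitable
      \<open>m\<close>, \<open>n\<close> unless \<open>b\<close> is 0 or 1.\<close>
    have id: "b * (1 - b) * of_int (m * n * (m - n)) * B 0 0 = 0" for m n
    proof -
      let ?m = "of_int m :: complex" and ?n = "of_int n :: complex"
      have "s * B m 0 = (s + b * ?m) * B 0 0" "s * B 0 n = (s + b * ?n) * B 0 0"
        using z(2)[of 0 m] z(1)[of 0 n] by simp_all
      hence "(?n + s) * ((?m + s + b * ?n) * (s + b * ?m)) * B 0 0
           = (?m + s) * ((?n + s + b * ?m) * (s + b * ?n)) * B 0 0"
        using z(1)[of m n] z(2)[of n m] by algebra
      thus ?thesis
        by (simp add: algebra_simps)
    qed
    show ?thesis using id[of 1 2] id[of 1 "-1"] by auto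
  qed
  then consider "b = 0" | "b = 1" | "b \<noteq> 0" "b \<noteq> 1" "B 0 0 = 0" by blast
  thus ?thesis
  proof cases
    case 1
    define c where "c = B 0 0"
    have "B m n - c = 0" for m n
      using density_biderivation_diff[OF B[unfolded 1] density_biderivation_model(1)]
      by (rule density_biderivation_eq_0_generic) (simp_all add: s c_def)
    thus ?thesis using 1 by auto
  next
    case 2
    \<comment> \<open>Chosen so that the model agrees with \<open>B\<close> at the origin.\<close>
    define c where "c = B 0 0 / s"
    have "B m n - (of_int (m + n) + s) * c = 0" for m n
      using density_biderivation_diff[OF B[unfolded 2] density_biderivation_model(2)]
      by (rule density_biderivation_eq_0_generic) (simp_all add: s c_def)
    thus ?thesis using 2 by auto
  next
    case 3
    thus ?thesis using density_biderivation_eq_0_generic[OF B s] by auto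
  qed
qed

lemma density_biderivation_special:
  assumes B: "density_biderivation 0 b B"
  shows "\<exists>c. \<forall>m n. B m n =
    (if b = 0 then c else if b = 1 then of_int (m + n) * c
     else if b = -1 then of_int (m - n) * c else 0)"
proof -
  have zl: "of_int m * B m n = (of_int m + b * of_int n) * B m 0"
    and zr: "of_int n * B m n = (of_int n + b * of_int m) * B 0 n" for m n
    using density_biderivation_zero[OF B] by simp_all
  \<comment> \<open>The exceptional point is now the origin, so it suffices to match a model
    \<open>M\<close> elsewhere: the difference is again a solution.\<close>
  have reduce: ?thesis
    if M: "density_biderivation 0 b M" and off: "\<And>m n. m \<noteq> 0 \<or> n \<noteq> 0 \<Longrightarrow> B m n = M m n"
      and M_eq: "\<And>m n. M m n = (if b = 0 then c else if b = 1 then of_int (m + n) * c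
        else if b = -1 then of_int (m - n) * c else 0)" for M c
  proof -
    have "B m n - M m n = 0" for m n
      using density_biderivation_diff[OF B M]
      by (rule density_biderivation_eq_0) (use off in auto)
    thus ?thesis using M_eq by auto
  qed
  show ?thesis
  proof (cases "b = 0")
    case True
    have l: "B m n = B m 0" if "m \<noteq> 0" for m n using zl[of m n] that True by simp
    have r: "B m n = B 0 n" if "n \<noteq> 0" for m n using zr[of n m] that True by simp
    show ?thesis
    proof (rule reduce[where c = "B 1 0"])
      show "density_biderivation 0 b (\<lambda>m n. B 1 0)"
        using density_biderivation_model(1) True by simp
      show "B m n = B 1 0" if "m \<noteq> 0 \<or> n \<noteq> 0" for m n
        using that l[of m n] l[of m 1] r[of 1 m] l[of 1 1] r[of n m] l[of 1 n] r[of n 1] r[of 1 1]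
        by auto
    qed (use True in auto)
  next
    case b0: False
    \<comment> \<open>Dividing the axis values by their index turns the comparison of the two
      expressions into the linear relation \<open>xy\<close> between \<open>x m\<close> and
      \<open>y n\<close>.\<close>
    define x where "x m = B m 0 / of_int m" for m
    define y where "y n = B 0 n / of_int n" for n
    have Bx: "B m n = (of_int m + b * of_int n) * x m" if "m \<noteq> 0" for m n
      using zl[of m n] that by (simp add: x_def nonzero_eq_divide_eq mult.commute)
    have By: "B m n = (of_int n + b * of_int m) * y n" if "n \<noteq> 0" for m n
      using zr[of n m] that by (simp add: y_def nonzero_eq_divide_eq mult.commute)
    have xy: "(of_int m + b * of_int n) * x m = (of_int n + b * of_int m) * y n"
      if "m \<noteq> 0" "n \<noteq> 0" for m n
      using Bx By that by metis
    consider "b = 1" | "b = -1" | "b \<noteq> 1" "b \<noteq> -1" by blast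
    thus ?thesis
    proof cases
      case 1
      have xy1: "x m = y n" if "m \<noteq> 0" "n \<noteq> 0" "m + n \<noteq> 0" for m n
      proof -
        have "of_int (m + n) * (x m - y n) = 0"
          using xy[OF that(1,2)] 1 by (simp add: algebra_simps)
        thus ?thesis using that(3) by (simp only: mult_eq_0_iff of_int_eq_0_iff) simp
      qed
      \<comment> \<open>The link through \<open>y 1\<close> is barred at \<open>m = -1\<close>;
        there \<open>y (-2)\<close> connects the two values.\<close>
      have x1: "x m = x 1" if "m \<noteq> 0" for m
        using xy1[of m 1] xy1[of 1 1] xy1[of m "-2"] xy1[of 1 "-2"] that by (cases "m = -1") auto
      have y1: "y n = x 1" if "n \<noteq> 0" for n
        using xy1[of n n] x1[of n] that by simp
      show ?thesis
      proof (rule reduce[where c = "x 1"])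
        show "density_biderivation 0 b (\<lambda>m n. of_int (m + n) * x 1)"
          using density_biderivation_model(2)[of 0] 1 by simp
        show "B m n = of_int (m + n) * x 1" if "m \<noteq> 0 \<or> n \<noteq> 0" for m n
          using that Bx[of m n] By[of n m] x1[of m] y1[of n] 1 by (auto simp: add.commute)
      qed (use 1 in auto)
    next
      case 2
      have xy1: "y n = - x m" if "m \<noteq> 0" "n \<noteq> 0" "m \<noteq> n" for m n
      proof -
        have "of_int (m - n) * (x m + y n) = 0"
          using xy[OF that(1,2)] 2 by (simp add: algebra_simps)
        hence "x m + y n = 0" using that(3) by (simp only: mult_eq_0_iff of_int_eq_0_iff) simp
        thus ?thesis by (simp add: eq_neg_iff_add_eq_0 add.commute)
      qed
      \<comment> \<open>The link through \<open>y (-1)\<close> is barred at \<open>m = -1\<close>;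
        there \<open>y 2\<close> connects the two values.\<close>
      have x1: "x m = x 1" if "m \<noteq> 0" for m
        using xy1[of m "-1"] xy1[of 1 "-1"] xy1[of m 2] xy1[of 1 2] that by (cases "m = -1") auto
      have y1: "y n = - x 1" if "n \<noteq> 0" for n
        using xy1[of "2 * n" n] x1[of "2 * n"] that by simp
      show ?thesis
      proof (rule reduce[where c = "x 1"])
        show "density_biderivation 0 b (\<lambda>m n. of_int (m - n) * x 1)"
          using density_biderivation_model(3) 2 by simp
        show "B m n = of_int (m - n) * x 1" if "m \<noteq> 0 \<or> n \<noteq> 0" for m n
          using that Bx[of m n] By[of n m] x1[of m] y1[of n] 2 by (auto simp: algebra_simps)
      qed (use 2 in auto)
    next
      case 3
      have sym: "y m = x m" if "m \<noteq> 0" for m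
      proof -
        have "of_int m * ((1 + b) * (x m - y m)) = 0"
          using xy[OF that that] by (simp add: algebra_simps)
        thus ?thesis using that 3(2) by (simp add: add_eq_0_iff)
      qed
      have odd: "x (- m) = - x m" if "m \<noteq> 0" for m
      proof -
        have "of_int m * ((1 - b) * (x m + x (- m))) = 0"
          using xy[of m "- m"] sym[of "- m"] that by (simp add: algebra_simps)
        hence "x m + x (- m) = 0" using that 3(1) by simp
        thus ?thesis by (simp add: eq_neg_iff_add_eq_0 add.commute)
      qed
      \<comment> \<open>The pairs \<open>(m, 2 * m)\<close> and \<open>(m, - 2 * m)\<close> give two
        linear equations in \<open>x m\<close> and \<open>x (2 * m)\<close> with determinant
        \<open>- 6 * b\<close>.\<close>
      have x0: "x m = 0" if "m \<noteq> 0" for m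
      proof -
        have "of_int m * ((1 + 2 * b) * x m - (2 + b) * x (2 * m)) = 0"
          using xy[of m "2 * m"] sym[of "2 * m"] that by (simp add: algebra_simps)
        moreover have "of_int m * ((1 - 2 * b) * x m - (2 - b) * x (2 * m)) = 0"
          using xy[of m "- (2 * m)"] sym[of "- (2 * m)"] odd[of "2 * m"] that
          by (simp add: algebra_simps)
        ultimately have "(1 + 2 * b) * x m - (2 + b) * x (2 * m) = 0"
          "(1 - 2 * b) * x m - (2 - b) * x (2 * m) = 0"
          using that by simp_all
        hence "6 * b * x m = 0" by algebra
        thus ?thesis using b0 by simp
      qed
      show ?thesis
      proof (rule reduce[where c = 0])
        show "density_biderivation 0 b (\<lambda>m n. 0)"
          by (simp add: density_biderivation_def)
        show "B m n = 0" if "m \<noteq> 0 \<or> n \<noteq> 0" for m n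
          using that Bx[of m n] By[of n m] x0[of m] x0[of n] sym[of n] by auto
      qed (use b0 3 in auto)
    qed
  qed
qed

lemma density_biderivation_cases:
  assumes B: "density_biderivation s b B"
  shows "\<exists>c. \<forall>m n. B m n =
    (if b = 0 then c else if b = 1 then (of_int (m + n) + s) * c
     else if b = -1 \<and> s = 0 then of_int (m - n) * c else 0)"
proof (cases "s = 0")
  case True
  thus ?thesis using density_biderivation_special[of b B] B by auto
next
  case False
  thus ?thesis using density_biderivation_generic[OF B] by auto
qed


section \<open>Biderivations of a Lie algebra\<close>

lemma bilinear_mapD:
  assumes "bilinear_map scale f"
  shows "f x (y + z) = f x y + f x z" "f (x + y) z = f x z + f y z"
    "f x (scale c y) = scale c (f x y)" "f (scale c x) y = scale c (f x y)"
  using assms by (auto simp: bilinear_map_def Vector_Spaces.linear_iff)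

lemma biderivationD:
  assumes "biderivation scale br f"
  shows "bilinear_map scale f" "f (br x y) z = br x (f y z) + br (f x z) y"
    "f x (br y z) = br (f x y) z + br y (f x z)"
  using assms by (auto simp: biderivation_def)

text \<open>Transfers results on one argument to the other.\<close>

lemma biderivation_swap:
  "biderivation scale br f \<Longrightarrow> biderivation scale br (\<lambda>x y. f y x)"
  by (auto simp: biderivation_def bilinear_map_def add.commute)

context lie_algebra
begin

lemma bracket_anticomm: "bracket y x = - bracket x y"
proof -
  note l = bilinear_mapD[OF bracket_bilinear]
  have "0 = bracket (x + y) (x + y)" by (simp add: bracket_self)
  also have "\<dots> = bracket x y + bracket y x"
    by (simp only: l) (simp add: bracket_self add.commute)
  finally have "bracket x y + bracket y x = 0" by simp
  thus ?thesis by (simp add: eq_neg_iff_add_eq_0 add.commute)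
qed

lemma bracket_minus: "bracket (- x) y = - bracket x y" "bracket x (- y) = - bracket x y"
  using bilinear_mapD(4)[OF bracket_bilinear, of "-1" x y]
    bilinear_mapD(3)[OF bracket_bilinear, of x "-1" y] by simp_all

text \<open>Both identities are the Jacobi identity rearranged by antisymmetry.\<close>

lemma biderivation_bracket: "biderivation scale bracket bracket"
proof -
  have eqs: "bracket (bracket x y) z = - bracket z (bracket x y)"
    "bracket (bracket x z) y = bracket y (bracket z x)"
    "bracket y (bracket x z) = - bracket y (bracket z x)" for x y z
    using bracket_anticomm[of z "bracket x y"] bracket_anticomm[of y "bracket x z"]
      bracket_anticomm[of z x]
    by (simp_all add: bracket_minus)
  have "bracket (bracket x y) z = bracket x (bracket y z) + bracket (bracket x z) y" for x y z
    using jacobi[of x y z] unfolding eqs(1)[of x y z] eqs(2)[of x z y]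
    by (simp add: neg_eq_iff_add_eq_0 ac_simps)
  moreover have "bracket x (bracket y z) = bracket (bracket x y) z + bracket y (bracket x z)" for x y z
    using jacobi[of x y z] unfolding eqs(1)[of x y z] eqs(3)[of y x z]
    by (simp add: eq_neg_iff_add_eq_0 algebra_simps)
  ultimately show ?thesis
    unfolding biderivation_def using bracket_bilinear by blast
qed

lemma biderivation_diff_scale:
  assumes f: "biderivation scale bracket f" and g: "biderivation scale bracket g"
  shows "biderivation scale bracket (\<lambda>x y. f x y - scale c (g x y))"
proof -
  note l = bilinear_mapD[OF bracket_bilinear]
  have br: "bracket x (u - scale c v) = bracket x u - scale c (bracket x v)"
    "bracket (u - scale c v) x = bracket u x - scale c (bracket v x)" for x u v
    using l(1)[of x "u - scale c v" "scale c v"] l(2)[of "u - scale c v" "scale c v" x]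
    by (simp_all add: l)
  note F = biderivationD[OF f] and G = biderivationD[OF g]
  show ?thesis
    unfolding biderivation_def bilinear_map_def Vector_Spaces.linear_iff
    by (auto simp: br F(2,3) G(2,3) bilinear_mapD[OF F(1)] bilinear_mapD[OF G(1)]
        scale_right_distrib scale_right_diff_distrib mult.commute intro: vector_space_axioms)
qed

end

lemma bilinear_map_eqI:
  assumes f: "bilinear_map wscale f" and g: "bilinear_map wscale g"
    and eq: "\<And>i j. f (wbasis i) (wbasis j) = g (wbasis i) (wbasis j)"
  shows "f x y = g x y"
proof -
  note lf = bilinear_mapD[OF f] and lg = bilinear_mapD[OF g]
  have z: "f u 0 = g u 0" "f 0 u = g 0 u" for u
    using lf(3)[of u 0 0] lg(3)[of u 0 0] lf(4)[of 0 0 u] lg(4)[of 0 0 u] by simp_all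
  have 1: "f (wbasis i) y = g (wbasis i) y" for i
  proof (induction y rule: W_induct)
    case (L m) show ?case using eq[of i "L_idx m"] by simp
  next
    case (I m) show ?case using eq[of i "I_idx m"] by simp
  qed (simp_all add: z lf lg)
  show ?thesis
  proof (induction x rule: W_induct)
    case (L m) show ?case using 1[of "L_idx m"] by simp
  next
    case (I m) show ?case using 1[of "I_idx m"] by simp
  qed (simp_all add: z lf lg)
qed


section \<open>Coefficients in \<open>W(a,b)\<close>\<close>

abbreviation coeffL :: "W \<Rightarrow> int \<Rightarrow> complex" where
  "coeffL x r \<equiv> Poly_Mapping.lookup x (L_idx r)"

abbreviation coeffI :: "W \<Rightarrow> int \<Rightarrow> complex" where
  "coeffI x r \<equiv> Poly_Mapping.lookup x (I_idx r)"

lemma W_eqI: "(\<And>r. coeffL x r = coeffL y r) \<Longrightarrow> (\<And>r. coeffI x r = coeffI y r) \<Longrightarrow> x = y"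
  by (rule poly_mapping_eqI) (metis windex.exhaust)

lemma coeff_basis [simp]:
  "coeffL (wL m) r = (if m = r then 1 else 0)" "coeffI (wL m) r = 0"
  "coeffI (wI m) r = (if m = r then 1 else 0)" "coeffL (wI m) r = 0"
  by (auto simp: wL_def wI_def lookup_single when_def)

lemma coeff_wbracket_L [simp]:
  "coeffL (wbracket a b (wL m) x) r = of_int (2 * m - r) * coeffL x (r - m)"
  "coeffI (wbracket a b (wL m) x) r = - ((of_int (r - m) + a + b * of_int m) * coeffI x (r - m))"
  by (induction x rule: W_induct) (auto simp: wbracket_linear_simps lookup_add distrib_left simp del: minus_add_distrib)

lemma coeff_wbracket_I [simp]:
  "coeffL (wbracket a b (wI n) x) r = 0"
  "coeffI (wbracket a b (wI n) x) r = (of_int n + a + b * of_int (r - n)) * coeffL x (r - n)"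
  by (induction x rule: W_induct) (auto simp: wbracket_linear_simps lookup_add distrib_left simp del: minus_add_distrib)

lemma coeff_wbracket_right [simp]:
  "coeffL (wbracket a b x (wL m)) r = - (of_int (2 * m - r) * coeffL x (r - m))"
  "coeffI (wbracket a b x (wL m)) r = (of_int (r - m) + a + b * of_int m) * coeffI x (r - m)"
  "coeffL (wbracket a b x (wI n)) r = 0"
  "coeffI (wbracket a b x (wI n)) r = - ((of_int n + a + b * of_int (r - n)) * coeffL x (r - n))"
  using W.bracket_anticomm[of a b x "wL m"] W.bracket_anticomm[of a b x "wI n"]
  by (simp_all add: algebra_simps)

section \<open>Coefficients of a biderivation on pairs of \<open>L\<close>'s\<close>

lemma biderivation_coeffL:
  assumes f: "biderivation wscale (wbracket a b) f"
  shows "density_biderivation (of_int k) (-1) (\<lambda>m n. coeffL (f (wL m) (wL n)) (m + n + k))"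
proof -
  note F = biderivationD[OF f] and l = bilinear_mapD[OF biderivationD(1)[OF f]]
  show ?thesis
    unfolding density_biderivation_def
  proof (intro conjI allI)
    fix m n p
    show "of_int (m - n) * coeffL (f (wL (m + n)) (wL p)) (m + n + p + k) =
      (of_int (m + p) + of_int k + - 1 * of_int n) * coeffL (f (wL m) (wL p)) (m + p + k)
      - (of_int (n + p) + of_int k + - 1 * of_int m) * coeffL (f (wL n) (wL p)) (n + p + k)"
      using arg_cong[OF F(2)[of "wL m" "wL n" "wL p"], of "\<lambda>x. coeffL x (m + n + p + k)"]
      by (simp add: l lookup_add) (simp add: algebra_simps)
    show "of_int (n - p) * coeffL (f (wL m) (wL (n + p))) (m + (n + p) + k) =
      (of_int (m + n) + of_int k + - 1 * of_int p) * coeffL (f (wL m) (wL n)) (m + n + k)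
      - (of_int (m + p) + of_int k + - 1 * of_int n) * coeffL (f (wL m) (wL p)) (m + p + k)"
      using arg_cong[OF F(3)[of "wL m" "wL n" "wL p"], of "\<lambda>x. coeffL x (m + (n + p) + k)"]
      by (simp add: l lookup_add) (simp add: algebra_simps)
  qed
qed

text \<open>Bracketing with \<open>wL m\<close> shifts indices by \<open>m\<close> and does not mix
  \<open>L\<close>- and \<open>I\<close>-coefficients. So each offset \<open>k\<close> gives a
  closed system, and \<open>k\<close> is absorbed into the shift \<open>s\<close>.\<close>

lemma biderivation_coeffI:
  assumes f: "biderivation wscale (wbracket a b) f"
  shows "density_biderivation (of_int k + a) b (\<lambda>m n. coeffI (f (wL m) (wL n)) (m + n + k))"
proof -
  note F = biderivationD[OF f] and l = bilinear_mapD[OF biderivationD(1)[OF f]]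
  show ?thesis
    unfolding density_biderivation_def
  proof (intro conjI allI)
    fix m n p
    show "of_int (m - n) * coeffI (f (wL (m + n)) (wL p)) (m + n + p + k) =
      (of_int (m + p) + (of_int k + a) + b * of_int n) * coeffI (f (wL m) (wL p)) (m + p + k)
      - (of_int (n + p) + (of_int k + a) + b * of_int m) * coeffI (f (wL n) (wL p)) (n + p + k)"
      using arg_cong[OF F(2)[of "wL m" "wL n" "wL p"], of "\<lambda>x. coeffI x (m + n + p + k)"]
      by (simp add: l lookup_add) (simp add: algebra_simps)
    show "of_int (n - p) * coeffI (f (wL m) (wL (n + p))) (m + (n + p) + k) =
      (of_int (m + n) + (of_int k + a) + b * of_int p) * coeffI (f (wL m) (wL n)) (m + n + k)
      - (of_int (m + p) + (of_int k + a) + b * of_int n) * coeffI (f (wL m) (wL p)) (m + p + k)"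
      using arg_cong[OF F(3)[of "wL m" "wL n" "wL p"], of "\<lambda>x. coeffI x (m + (n + p) + k)"]
      by (simp add: l lookup_add) (simp add: algebra_simps)
  qed
qed

text \<open>With \<open>b = -1\<close> a nonzero solution needs \<open>s = 0\<close>, so only the
  offset 0 survives. Its constant is the scalar \<lambda> of the theorem.\<close>

lemma biderivation_coeffL_eq:
  assumes f: "biderivation wscale (wbracket a b) f"
  shows "\<exists>l. \<forall>m n r. coeffL (f (wL m) (wL n)) r = (if r = m + n then of_int (m - n) * l else 0)"
proof -
  have ex: "\<exists>c. \<forall>m n. coeffL (f (wL m) (wL n)) (m + n + k) = (if k = 0 then of_int (m - n) * c else 0)"
    for k
    using density_biderivation_cases[OF biderivation_coeffL[OF f, of k]] by simp
  obtain l where l: "\<And>m n. coeffL (f (wL m) (wL n)) (m + n) = of_int (m - n) * l"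
    using ex[of 0] by auto
  have "coeffL (f (wL m) (wL n)) r = 0" if "r \<noteq> m + n" for m n r
  proof -
    from ex[of "r - (m + n)"] obtain c where
      "coeffL (f (wL m) (wL n)) (m + n + (r - (m + n))) =
        (if r - (m + n) = 0 then of_int (m - n) * c else 0)" by blast
    thus ?thesis using that by simp
  qed
  thus ?thesis using l by auto
qed

section \<open>Vanishing when an argument is some \<open>I\<close>\<close>

lemma biderivation_LI_eq_0:
  assumes f: "biderivation wscale (wbracket a b) f"
    and LL: "\<And>m n r. coeffL (f (wL m) (wL n)) r = 0"
  shows "f (wL m) (wI n) = 0"
proof -
  note F = biderivationD[OF f] and l = bilinear_mapD[OF biderivationD(1)[OF f]]
  \<comment> \<open>\<open>L\<^sub>m\<close> becomes a nonzero multiple of the bracket of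
    \<open>L\<^sub>p\<close> and \<open>L\<^sub>q\<close>, both with nonzero index.\<close>
  define p where "p = \<bar>m\<bar> + 1"
  define q where "q = m - p"
  have pq: "p \<noteq> 0" "q \<noteq> 0" "p \<noteq> q" "p + q = m" by (auto simp: p_def q_def)
  text \<open>\<open>f (wL k) (wI n)\<close> has the same weight under \<open>L\<^sub>0\<close> as \<open>wI n\<close>.\<close>
  have weightL: "(of_int n + a - of_int r) * coeffL (f (wL k) (wI n)) r = 0" for k r
    using arg_cong[OF F(3)[of "wL k" "wL 0" "wI n"], of "\<lambda>x. coeffL x r"]
    by (simp add: l lookup_add) (simp add: algebra_simps, metis distrib_right mult_cancel_right)
  have weightI: "of_int (n - r) * coeffI (f (wL k) (wI n)) r = 0" for k r
    using arg_cong[OF F(3)[of "wL k" "wL 0" "wI n"], of "\<lambda>x. coeffI x r"]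
    by (simp add: l lookup_add LL) (auto simp: algebra_simps)
  show ?thesis
  proof (rule W_eqI)
    fix r
    \<comment> \<open>The only index that the weight allows is the same for every \<open>k\<close>,
      while bracketing with \<open>wL p\<close> or \<open>wL q\<close> moves it; hence nothing can
      stand there.\<close>
    have "of_int (p - q) * coeffL (f (wL m) (wI n)) r = 0" if "of_int n + a = of_int r"
    proof -
      have "coeffL (f (wL k) (wI n)) t = 0" if "t \<noteq> r" for k t
        using weightL[of t k] that \<open>of_int n + a = of_int r\<close> by simp
      thus ?thesis
        using arg_cong[OF F(2)[of "wL p" "wL q" "wI n"], of "\<lambda>x. coeffL x r"] pq
        by (simp add: l lookup_add)
    qed
    thus "coeffL (f (wL m) (wI n)) r = coeffL 0 r"
      using weightL[of r m] pq(3) by auto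
  next
    fix r
    have 0: "coeffI (f (wL k) (wI n)) t = 0" if "t \<noteq> n" for k t
      using weightI[of t k] that by simp
    hence "of_int (p - q) * coeffI (f (wL m) (wI n)) n = 0"
      using arg_cong[OF F(2)[of "wL p" "wL q" "wI n"], of "\<lambda>x. coeffI x n"] pq
      by (simp add: l lookup_add)
    thus "coeffI (f (wL m) (wI n)) r = coeffI 0 r"
      using 0[of r m] pq(3) by (cases "r = n") auto
  qed
qed

lemma biderivation_II_offdiag:
  assumes f: "biderivation wscale (wbracket a b) f"
    and IL: "\<And>m n. f (wI m) (wL n) = 0"
  shows "coeffL (f (wI m) (wI n)) r = 0 \<or> of_int n + a = of_int r"
    "coeffI (f (wI m) (wI n)) r = 0 \<or> r = n"
proof -
  note F = biderivationD[OF f] and l = bilinear_mapD[OF biderivationD(1)[OF f]]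
  have "(of_int n + a - of_int r) * coeffL (f (wI m) (wI n)) r = 0"
    using arg_cong[OF F(3)[of "wI m" "wL 0" "wI n"], of "\<lambda>x. coeffL x r"]
    by (simp add: l lookup_add IL) (simp add: algebra_simps, metis distrib_right mult_cancel_right)
  thus "coeffL (f (wI m) (wI n)) r = 0 \<or> of_int n + a = of_int r" by auto
  have "of_int (n - r) * coeffI (f (wI m) (wI n)) r = 0"
    using arg_cong[OF F(3)[of "wI m" "wL 0" "wI n"], of "\<lambda>x. coeffI x r"]
    by (simp add: l lookup_add IL) (auto simp: algebra_simps)
  thus "coeffI (f (wI m) (wI n)) r = 0 \<or> r = n" by auto
qed

text \<open>The \<open>L\<^sub>0\<close>-weight of the value is that of either argument, which
  forces \<open>m = n\<close>. The diagonal is then linked by brackets to the vanishing off-diagonal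
  values.\<close>

lemma biderivation_II_eq_0:
  assumes f: "biderivation wscale (wbracket a b) f"
    and LI: "\<And>m n. f (wL m) (wI n) = 0" and IL: "\<And>m n. f (wI m) (wL n) = 0"
  shows "f (wI m) (wI n) = 0"
proof -
  note F = biderivationD[OF f] and l = bilinear_mapD[OF biderivationD(1)[OF f]]
  note off = biderivation_II_offdiag[OF f IL]
    and off' = biderivation_II_offdiag[OF biderivation_swap[OF f] LI]
  have ne: "f (wI m) (wI n) = 0" if "m \<noteq> n" for m n
  proof (rule W_eqI)
    show "coeffL (f (wI m) (wI n)) r = coeffL 0 r" for r
      using off(1)[of m n r] off'(1)[of m n r] that by (metis add_right_cancel lookup_zero of_int_eq_iff)
    show "coeffI (f (wI m) (wI n)) r = coeffI 0 r" for r
      using off(2)[of m n r] off'(2)[of m n r] that by auto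
  qed
  have "f (wI n) (wI n) = 0"
  proof (rule W_eqI)
    \<comment> \<open>The left side of the identity is a multiple of
      \<open>f (wI (p + n)) (wI n)\<close>, which is off the diagonal.\<close>
    have inv: "wbracket a b (wL p) (f (wI n) (wI n)) = 0" if "p \<noteq> 0" for p
      using F(2)[of "wL p" "wI n" "wI n"] that by (simp add: l LI ne)
    show "coeffL (f (wI n) (wI n)) r = coeffL 0 r" for r
    proof -
      define p where "p = \<bar>r\<bar> + 1"
      have "p \<noteq> 0" "p \<noteq> r" by (auto simp: p_def)
      thus ?thesis using arg_cong[OF inv[of p], of "\<lambda>x. coeffL x (r + p)"] by simp
    qed
    have "(of_int n + a + b * of_int p) * coeffI (f (wI n) (wI n)) n = 0" if "p \<noteq> 0" for p
      using arg_cong[OF inv[OF that], of "\<lambda>x. coeffI x (n + p)"] by simp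
    from this[of 1] this[of 2] have "(of_int n + a + b) * coeffI (f (wI n) (wI n)) n = 0"
      "(of_int n + a + b * 2) * coeffI (f (wI n) (wI n)) n = 0" by simp_all
    \<comment> \<open>The equations for \<open>p = 1\<close> and \<open>p = 2\<close> leave open the
      case \<open>b = 0\<close>, \<open>n + a = 0\<close>; there this third factor equals 1.\<close>
    moreover have "(of_int n + a + 1 - b) * coeffI (f (wI n) (wI n)) n = 0"
      using arg_cong[OF F(2)[of "wL (-1)" "wI (n + 1)" "wI n"], of "\<lambda>x. coeffI x n"]
      by (simp add: l LI ne) (auto simp: algebra_simps)
    ultimately have "coeffI (f (wI n) (wI n)) n = 0" by algebra
    thus "coeffI (f (wI n) (wI n)) r = coeffI 0 r" for r
      using off(2)[of n n r] by auto
  qed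
  thus ?thesis using ne by (cases "m = n") auto
qed

section \<open>Reduction to the values on pairs of \<open>L\<close>'s and the exceptional
  families\<close>

lemma biderivation_eq_LL:
  assumes f: "biderivation wscale (wbracket a b) f"
    and LL: "\<And>m n r. coeffL (f (wL m) (wL n)) r = 0"
    and g: "\<And>m n. f (wL m) (wL n) = g m n"
  shows "f x y = bilinear_ext (LL_basis g) x y"
proof (rule bilinear_map_eqI[where f = f and g = "bilinear_ext (LL_basis g)"])
  have LI: "f (wL m) (wI n) = 0" for m n
    by (rule biderivation_LI_eq_0[OF f LL])
  have IL: "f (wI m) (wL n) = 0" for m n
    by (rule biderivation_LI_eq_0[OF biderivation_swap[OF f] LL])
  show "f (wbasis i) (wbasis j) = bilinear_ext (LL_basis g) (wbasis i) (wbasis j)" for i j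
    unfolding bilinear_ext_basis
    by (cases i; cases j) (simp_all add: g LI IL biderivation_II_eq_0[OF f LI IL])
qed (use biderivationD[OF f] bilinear_ext_bilinear in auto)

text \<open>The weight \<open>h\<close> lets one computation serve both \<open>Psi\<close>, with
  \<open>h\<close> constantly 1, and \<open>Upsilon\<close>.\<close>

lemma coeff_finite_sum:
  assumes "finite {k. \<Omega> k \<noteq> 0}"
  shows "coeffL (\<Sum>k | \<Omega> k \<noteq> 0. wscale (h k * \<Omega> k) (wI (t + k))) r = 0"
    "coeffI (\<Sum>k | \<Omega> k \<noteq> 0. wscale (h k * \<Omega> k) (wI (t + k))) r = h (r - t) * \<Omega> (r - t)"
proof -
  show "coeffL (\<Sum>k | \<Omega> k \<noteq> 0. wscale (h k * \<Omega> k) (wI (t + k))) r = 0"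
    by (simp add: lookup_sum)
  have "coeffI (\<Sum>k | \<Omega> k \<noteq> 0. wscale (h k * \<Omega> k) (wI (t + k))) r =
      (\<Sum>k | \<Omega> k \<noteq> 0. if k = r - t then h k * \<Omega> k else 0)"
    unfolding lookup_sum by (intro sum.cong) auto
  also have "\<dots> = h (r - t) * \<Omega> (r - t)"
    using assms by (simp add: sum.delta)
  finally show "coeffI (\<Sum>k | \<Omega> k \<noteq> 0. wscale (h k * \<Omega> k) (wI (t + k))) r = h (r - t) * \<Omega> (r - t)" .
qed

theorem theorem3p2:
  fixes a b :: complex and f :: "W \<Rightarrow> W \<Rightarrow> W"
  assumes "biderivation wscale (wbracket a b) f"
  shows "\<exists>(l :: complex) (\<mu> :: complex) (\<Omega> :: int \<Rightarrow> complex).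
    finite {k. \<Omega> k \<noteq> 0} \<and>
    (\<forall>x y. f x y =
      (if b = 0 then wscale l (wbracket a b x y) + Psi \<Omega> x y
       else if b = 1 then wscale l (wbracket a b x y) + Upsilon a \<Omega> x y
       else if a \<in> \<int> \<and> b = -1 then wscale l (wbracket a b x y) + Theta a \<mu> x y
       else wscale l (wbracket a b x y)))"
proof -
  obtain l where l: "\<And>m n r. coeffL (f (wL m) (wL n)) r = (if r = m + n then of_int (m - n) * l else 0)"
    using biderivation_coeffL_eq[OF assms] by blast
  define g where "g x y = f x y - wscale l (wbracket a b x y)" for x y
  have g: "biderivation wscale (wbracket a b) g"
    unfolding g_def by (rule W.biderivation_diff_scale[OF assms W.biderivation_bracket])
  have f_eq: "f x y = wscale l (wbracket a b x y) + g x y" for x y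
    by (simp add: g_def)
  have gL: "coeffL (g (wL m) (wL n)) r = 0" for m n r
    by (simp add: g_def lookup_minus l)
  note g_ext = biderivation_eq_LL[OF g gL]
  \<comment> \<open>Each offset \<open>k\<close> has its own constant; together they form the
    candidate for \<open>\<Omega>\<close>.\<close>
  have "\<exists>c. \<forall>k m n. coeffI (g (wL m) (wL n)) (m + n + k) =
      (if b = 0 then c k else if b = 1 then (of_int (m + n) + (of_int k + a)) * c k
       else if b = -1 \<and> of_int k + a = 0 then of_int (m - n) * c k else 0)"
    by (intro choice allI density_biderivation_cases biderivation_coeffI[OF g])
  then obtain c where c: "\<And>k m n. coeffI (g (wL m) (wL n)) (m + n + k) =
      (if b = 0 then c k else if b = 1 then (of_int (m + n) + (of_int k + a)) * c k
       else if b = -1 \<and> of_int k + a = 0 then of_int (m - n) * c k else 0)"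
    by blast
  have c': "coeffI (g (wL m) (wL n)) r =
      (if b = 0 then c (r - (m + n)) else if b = 1 then (of_int r + a) * c (r - (m + n))
       else if b = -1 \<and> of_int (r - (m + n)) + a = 0 then of_int (m - n) * c (r - (m + n)) else 0)"
    for m n r
    using c[of m n "r - (m + n)"] by simp
  \<comment> \<open>Finite support of \<open>\<Omega>\<close> is inherited from the single vector
    \<open>g (wL 0) (wL 0)\<close>, from which the constants are read off when \<open>b\<close> is 0
    or 1.\<close>
  have fin0: "finite {k. coeffI (g (wL 0) (wL 0)) k \<noteq> 0}"
  proof (rule finite_surj)
    show "finite (Poly_Mapping.keys (g (wL 0) (wL 0)))" by simp
    show "{k. coeffI (g (wL 0) (wL 0)) k \<noteq> 0} \<subseteq>
        (\<lambda>i. case i of L_idx k \<Rightarrow> k | I_idx k \<Rightarrow> k) ` Poly_Mapping.keys (g (wL 0) (wL 0))"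
      by (force simp: in_keys_iff image_iff)
  qed
  consider "b = 0" | "b = 1" | "a \<in> \<int>" "b = -1" | "b \<noteq> 0" "b \<noteq> 1" "\<not> (a \<in> \<int> \<and> b = -1)"
    by blast
  thus ?thesis
  proof cases
    case 1
    have fin: "finite {k. c k \<noteq> 0}"
      using fin0 c'[of 0 0] 1 by simp
    have "g (wL m) (wL n) = (\<Sum>k | c k \<noteq> 0. wscale (c k) (wI (m + n + k)))" for m n
      using coeff_finite_sum[OF fin, of "\<lambda>_. 1" "m + n"] c'[of m n] gL[of m n] 1
      by (intro W_eqI) simp_all
    hence "g x y = Psi c x y" for x y
      unfolding Psi_def by (rule g_ext)
    thus ?thesis using fin 1 f_eq by auto
  next
    case 2
    \<comment> \<open>Here \<open>g (wL 0) (wL 0)\<close> only shows \<open>(k + a) * c k\<close>,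
      so \<open>c\<close> stays unseen at \<open>k = - a\<close>; that adds at most one
      index.\<close>
    have "{k. c k \<noteq> 0} \<subseteq> {k. coeffI (g (wL 0) (wL 0)) k \<noteq> 0} \<union> {\<lfloor>Re (- a)\<rfloor>}"
    proof
      fix k assume "k \<in> {k. c k \<noteq> 0}"
      moreover have "k = \<lfloor>Re (- a)\<rfloor>" if "of_int k + a = 0"
      proof -
        have "- a = of_int k" using that by (simp add: add_eq_0_iff)
        thus ?thesis by (simp only: complex_Re_of_int floor_of_int)
      qed
      ultimately show "k \<in> {k. coeffI (g (wL 0) (wL 0)) k \<noteq> 0} \<union> {\<lfloor>Re (- a)\<rfloor>}"
        using c'[of 0 0 k] 2 by auto
    qed
    hence fin: "finite {k. c k \<noteq> 0}"
      using fin0 by (meson finite.emptyI finite.insertI finite_UnI finite_subset)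
    have "g (wL m) (wL n) =
        (\<Sum>k | c k \<noteq> 0. wscale ((of_int (m + n + k) + a) * c k) (wI (m + n + k)))" for m n
      using coeff_finite_sum[OF fin, of "\<lambda>k. of_int (m + n + k) + a" "m + n"] c'[of m n] gL[of m n] 2
      by (intro W_eqI) simp_all
    hence "g x y = Upsilon a c x y" for x y
      unfolding Upsilon_def by (rule g_ext)
    thus ?thesis using fin 2 f_eq by auto
  next
    case 3
    then obtain z where z: "a = of_int z" by (auto elim: Ints_cases)
    have k: "of_int k + a = 0 \<longleftrightarrow> k = - z" for k
      using z by (metis add.commute add_eq_0_iff2 of_int_add of_int_eq_0_iff)
    \<comment> \<open>Only the offset \<open>- z\<close> makes the shift \<open>k + a\<close> zero,
      so a single constant remains, and it serves as \<open>\<mu>\<close>.\<close>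
    have "coeffI (g (wL m) (wL n)) r = (if m + n - z = r then of_int (m - n) * c (- z) else 0)" for m n r
      by (simp only: c' k) (use 3(2) in auto)
    hence "g (wL m) (wL n) = wscale (of_int (m - n) * c (- z)) (wI (m + n - \<lfloor>Re a\<rfloor>))" for m n
      using gL[of m n] z by (intro W_eqI) simp_all
    hence "g x y = Theta a (c (- z)) x y" for x y
      unfolding Theta_def by (rule g_ext)
    thus ?thesis using 3 f_eq by (intro exI[of _ l] exI[of _ "c (- z)"] exI[of _ "\<lambda>_. 0"]) auto
  next
    case 4
    \<comment> \<open>For \<open>b = -1\<close> a surviving offset would force \<open>a\<close> to
      be an integer, which this case excludes.\<close>
    have "a \<in> \<int>" if "of_int k + a = 0" for k :: int
      using that by (metis Ints_minus Ints_of_int add_eq_0_iff)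
    hence k: "\<not> (b = -1 \<and> of_int k + a = 0)" for k :: int
      using 4(3) by blast
    have "coeffI (g (wL m) (wL n)) r = 0" for m n r
      by (simp only: c' k) (use 4 in auto)
    hence "g (wL m) (wL n) = 0" for m n
      using gL[of m n] by (intro W_eqI) simp_all
    hence "g x y = bilinear_ext (LL_basis (\<lambda>m n. 0)) x y" for x y
      by (rule g_ext)
    moreover have "LL_basis (\<lambda>m n. 0) i j = 0" for i j
      by (cases i; cases j) simp_all
    ultimately have "g x y = 0" for x y
      by (simp add: bilinear_ext_def)
    thus ?thesis using 4 f_eq by (intro exI[of _ l] exI[of _ 0] exI[of _ "\<lambda>_. 0"]) auto
  qed
qed

end
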